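(* Let $\Gamma$ be a set of ESG (or ESG-equivalent) axioms and let $n\in\mathbb{N}$ be a natural number. If, for any linearly ordered set $Y$ with $n$ elements, there exists no binary relation on $\mathcal{Y} = 2^Y\setminus\{\emptyset\}$ satisfying $\Gamma$, then also for any linearly ordered set $X$ with more than $n$ elements there is no binary relation on $\mathcal{X} = 2^X\setminus\{\emptyset\}$ that satisfies $\Gamma$.
   Context: MSLSP (many-sorted logic for set preferences) is the many-sorted first-order language (with equality) with two sorts, $\varepsilon$ (elements) and $\sigma$ (sets), and the following signature. Relation symbols: $\in$ of type $\langle\varepsilon,\sigma\rangle$; $\dot{\geq}$ of type $\langle\varepsilon,\varepsilon\rangle$; $\succeq$ of type $\langle\sigma,\sigma\rangle$; $\subseteq$ of type $\langle\sigma,\sigma\rangle$; $\mathrm{disjoint}$ of type $\langle\sigma,\sigma\rangle$; $\mathrm{evencard}$ of type $\langle\sigma\rangle$; $\mathrm{equalcard}$ of type $\langle\sigma,\sigma\rangle$. Function symbols: $\cup$, taking two arguments of sort $\sigma$ to sort $\sigma$; $\{\cdot\}$, taking an argument of sort $\varepsilon$ to sort $\sigma$; $\mathrm{replaceInBy}$, taking arguments of sorts $\varepsilon,\sigma,\varepsilon$ to sort $\sigma$. A structure has a separate domain $\mathrm{dom}_s$ for each sort $s\in\{\varepsilon,\sigma\}$, and the quantifiers $\forall_s,\exists_s$ range over $\mathrm{dom}_s$. An MSLSP-structure $\mathfrak{B}$ is a *structure for set preferences* if $\mathrm{dom}_\sigma(\mathfrak{B}) \subseteq 2^{\mathrm{dom}_\varepsilon(\mathfrak{B})}$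 and $\in$ is interpreted as actual membership. The class of *existentially set-guarded* (ESG) formulas is the smallest class of MSLSP-formulas such that: - all quantifier-free formulas are ESG; - if $\psi(\bar{x})$ and $\psi'(\bar{x})$ are ESG, then $(\psi\wedge\psi')(\bar{x})$ and $(\psi\vee\psi')(\bar{x})$ are ESG; - if $\psi(y,\bar{x})$ is ESG, then $\forall_s y\,\psi(y,\bar{x})$ is ESG for any sort $s\in\{\varepsilon,\sigma\}$; - if $\psi(y,\bar{x})$ is ESG, then $\exists_\varepsilon y\,(y\in t(\bar{x})\wedge\psi(y,\bar{x}))$ is ESG, where $t$ is a term of sort $\sigma$ and $y$ (a variable of sort $\varepsilon$) does not occur in $\bar{x}$. An *axiom* is an MSLSP-sentence. An axiom is *ESG-equivalent* if it is equivalent, in all structures for set preferences, to an ESG sentence. A linearly ordered set $X$ carries a reflexive, complete, transitive and antisymmetric relation $\dot{\geq}$. A set $X$ linearly ordered by $\dot{\geq}$ together with a binary relation $\succeq$ on $\mathcal{X}=2^X\setminus\{\emptyset\}$ is viewed as an MSLSP-structure with $\mathrm{dom}_\varepsilon = X$ and $\mathrm{dom}_\sigma=\mathcal{X}$, in which $\dot{\geq}$ and $\succeq$ are interpreted by the given relations and all other symbols by their natural meaning: $\in$ is membership, $\subseteq$ is inclusion, $\mathrm{disjoint}(A,B)$ holds iff $A\cap B=\emptyset$, $\mathrm{evencard}(A)$ holds iff $|A|$ is even, $\mathrm{equalcard}(A,B)$ holds iff $|A|=|B|$, $\cup$ is union, $\{\cdot\}$ maps $x$ to $\{x\}$, and $\mathrm{replaceInBy}(a,A,b)=(A\setminus\{a\})\cup\{b\}$.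 The relation $\succeq$ *satisfies* $\Gamma$ if every axiom in $\Gamma$ is true in this structure. *)

theory Defs
  imports "HOL-Library.Equipollence"
begin

section \<open>Syntax\<close>

text \<open>
  Variables of the two sorts live in separate name spaces.  The signature has no function symbol with
  values of sort \<open>\<epsilon>\<close>, so terms of that sort are just variables.
\<close>

datatype eterm = EVar nat

datatype sterm =
    SVar nat
  | Cup sterm sterm
  | Sing eterm
  | ReplaceInBy eterm sterm eterm

text \<open>Implication and equivalence are the usual abbreviations over the connectives given here.\<close>

datatype fm =
    EqE eterm eterm
  | EqS sterm sterm
  | Mem eterm sterm
  | Geq eterm eterm
  | Pref sterm sterm
  | Subset sterm sterm
  | Disjoint sterm sterm
  | Evencard sterm
  | Equalcard sterm sterm
  | Neg fm
  | And fm fm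
  | Or fm fm
  | AllE nat fm
  | AllS nat fm
  | ExE nat fm
  | ExS nat fm

primrec evars_eterm :: "eterm \<Rightarrow> nat set" where
  "evars_eterm (EVar i) = {i}"

primrec evars_sterm :: "sterm \<Rightarrow> nat set" where
  "evars_sterm (SVar i) = {}"
| "evars_sterm (Cup t u) = evars_sterm t \<union> evars_sterm u"
| "evars_sterm (Sing a) = evars_eterm a"
| "evars_sterm (ReplaceInBy a t b) = evars_eterm a \<union> evars_sterm t \<union> evars_eterm b"

primrec svars_sterm :: "sterm \<Rightarrow> nat set" where
  "svars_sterm (SVar i) = {i}"
| "svars_sterm (Cup t u) = svars_sterm t \<union> svars_sterm u"
| "svars_sterm (Sing a) = {}"
| "svars_sterm (ReplaceInBy a t b) = svars_sterm t"

primrec free_evars :: "fm \<Rightarrow> nat set" where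
  "free_evars (EqE a b) = evars_eterm a \<union> evars_eterm b"
| "free_evars (EqS t u) = evars_sterm t \<union> evars_sterm u"
| "free_evars (Mem a t) = evars_eterm a \<union> evars_sterm t"
| "free_evars (Geq a b) = evars_eterm a \<union> evars_eterm b"
| "free_evars (Pref t u) = evars_sterm t \<union> evars_sterm u"
| "free_evars (Subset t u) = evars_sterm t \<union> evars_sterm u"
| "free_evars (Disjoint t u) = evars_sterm t \<union> evars_sterm u"
| "free_evars (Evencard t) = evars_sterm t"
| "free_evars (Equalcard t u) = evars_sterm t \<union> evars_sterm u"
| "free_evars (Neg \<phi>) = free_evars \<phi>"
| "free_evars (And \<phi> \<psi>) = free_evars \<phi> \<union> free_evars \<psi>"
| "free_evars (Or \<phi> \<psi>) = free_evars \<phi> \<union> free_evars \<psi>"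
| "free_evars (AllE i \<phi>) = free_evars \<phi> - {i}"
| "free_evars (AllS i \<phi>) = free_evars \<phi>"
| "free_evars (ExE i \<phi>) = free_evars \<phi> - {i}"
| "free_evars (ExS i \<phi>) = free_evars \<phi>"

primrec free_svars :: "fm \<Rightarrow> nat set" where
  "free_svars (EqE a b) = {}"
| "free_svars (EqS t u) = svars_sterm t \<union> svars_sterm u"
| "free_svars (Mem a t) = svars_sterm t"
| "free_svars (Geq a b) = {}"
| "free_svars (Pref t u) = svars_sterm t \<union> svars_sterm u"
| "free_svars (Subset t u) = svars_sterm t \<union> svars_sterm u"
| "free_svars (Disjoint t u) = svars_sterm t \<union> svars_sterm u"
| "free_svars (Evencard t) = svars_sterm t"
| "free_svars (Equalcard t u) = svars_sterm t \<union> svars_sterm u"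
| "free_svars (Neg \<phi>) = free_svars \<phi>"
| "free_svars (And \<phi> \<psi>) = free_svars \<phi> \<union> free_svars \<psi>"
| "free_svars (Or \<phi> \<psi>) = free_svars \<phi> \<union> free_svars \<psi>"
| "free_svars (AllE i \<phi>) = free_svars \<phi>"
| "free_svars (AllS i \<phi>) = free_svars \<phi> - {i}"
| "free_svars (ExE i \<phi>) = free_svars \<phi>"
| "free_svars (ExS i \<phi>) = free_svars \<phi> - {i}"

definition sentence :: "fm \<Rightarrow> bool" where
  "sentence \<phi> \<longleftrightarrow> free_evars \<phi> = {} \<and> free_svars \<phi> = {}"

primrec quantifier_free :: "fm \<Rightarrow> bool" where
  "quantifier_free (EqE a b) = True"
| "quantifier_free (EqS t u) = True"
| "quantifier_free (Mem a t) = True"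
| "quantifier_free (Geq a b) = True"
| "quantifier_free (Pref t u) = True"
| "quantifier_free (Subset t u) = True"
| "quantifier_free (Disjoint t u) = True"
| "quantifier_free (Evencard t) = True"
| "quantifier_free (Equalcard t u) = True"
| "quantifier_free (Neg \<phi>) = quantifier_free \<phi>"
| "quantifier_free (And \<phi> \<psi>) = (quantifier_free \<phi> \<and> quantifier_free \<psi>)"
| "quantifier_free (Or \<phi> \<psi>) = (quantifier_free \<phi> \<and> quantifier_free \<psi>)"
| "quantifier_free (AllE i \<phi>) = False"
| "quantifier_free (AllS i \<phi>) = False"
| "quantifier_free (ExE i \<phi>) = False"
| "quantifier_free (ExS i \<phi>) = False"

inductive esg :: "fm \<Rightarrow> bool" where
  esg_qf: "quantifier_free \<phi> \<Longrightarrow> esg \<phi>"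
| esg_And: "esg \<phi> \<Longrightarrow> esg \<psi> \<Longrightarrow> esg (And \<phi> \<psi>)"
| esg_Or: "esg \<phi> \<Longrightarrow> esg \<psi> \<Longrightarrow> esg (Or \<phi> \<psi>)"
| esg_AllE: "esg \<phi> \<Longrightarrow> esg (AllE i \<phi>)"
| esg_AllS: "esg \<phi> \<Longrightarrow> esg (AllS i \<phi>)"
| esg_ExE: "esg \<phi> \<Longrightarrow> i \<notin> evars_sterm t \<Longrightarrow> esg (ExE i (And (Mem (EVar i) t) \<phi>))"


section \<open>Semantics\<close>

record ('e, 's) mslsp =
  dom_elem :: "'e set"
  dom_set :: "'s set"
  mem_rel :: "'e \<Rightarrow> 's \<Rightarrow> bool"
  geq_rel :: "'e \<Rightarrow> 'e \<Rightarrow> bool"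
  pref_rel :: "'s \<Rightarrow> 's \<Rightarrow> bool"
  subset_rel :: "'s \<Rightarrow> 's \<Rightarrow> bool"
  disjoint_rel :: "'s \<Rightarrow> 's \<Rightarrow> bool"
  evencard_rel :: "'s \<Rightarrow> bool"
  equalcard_rel :: "'s \<Rightarrow> 's \<Rightarrow> bool"
  cup_fun :: "'s \<Rightarrow> 's \<Rightarrow> 's"
  sing_fun :: "'e \<Rightarrow> 's"
  replace_fun :: "'e \<Rightarrow> 's \<Rightarrow> 'e \<Rightarrow> 's"

text \<open>
  Relations and functions are total on the HOL types, but only their values on the domains matter.
  The domains may be empty: this is what makes the set \<open>Y = {}\<close> give rise to a structure as well.
\<close>

definition mslsp_structure :: "('e, 's) mslsp \<Rightarrow> bool" where
  "mslsp_structure M \<longleftrightarrow>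
     (\<forall>A \<in> dom_set M. \<forall>B \<in> dom_set M. cup_fun M A B \<in> dom_set M) \<and>
     (\<forall>x \<in> dom_elem M. sing_fun M x \<in> dom_set M) \<and>
     (\<forall>x \<in> dom_elem M. \<forall>A \<in> dom_set M. \<forall>y \<in> dom_elem M. replace_fun M x A y \<in> dom_set M)"

primrec eval_e :: "(nat \<Rightarrow> 'e) \<Rightarrow> eterm \<Rightarrow> 'e" where
  "eval_e e (EVar i) = e i"

primrec eval_s :: "('e, 's) mslsp \<Rightarrow> (nat \<Rightarrow> 'e) \<Rightarrow> (nat \<Rightarrow> 's) \<Rightarrow> sterm \<Rightarrow> 's" where
  "eval_s M e s (SVar i) = s i"
| "eval_s M e s (Cup t u) = cup_fun M (eval_s M e s t) (eval_s M e s u)"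
| "eval_s M e s (Sing a) = sing_fun M (eval_e e a)"
| "eval_s M e s (ReplaceInBy a t b) = replace_fun M (eval_e e a) (eval_s M e s t) (eval_e e b)"

primrec sat :: "('e, 's) mslsp \<Rightarrow> (nat \<Rightarrow> 'e) \<Rightarrow> (nat \<Rightarrow> 's) \<Rightarrow> fm \<Rightarrow> bool" where
  "sat M e s (EqE a b) \<longleftrightarrow> eval_e e a = eval_e e b"
| "sat M e s (EqS t u) \<longleftrightarrow> eval_s M e s t = eval_s M e s u"
| "sat M e s (Mem a t) \<longleftrightarrow> mem_rel M (eval_e e a) (eval_s M e s t)"
| "sat M e s (Geq a b) \<longleftrightarrow> geq_rel M (eval_e e a) (eval_e e b)"
| "sat M e s (Pref t u) \<longleftrightarrow> pref_rel M (eval_s M e s t) (eval_s M e s u)"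
| "sat M e s (Subset t u) \<longleftrightarrow> subset_rel M (eval_s M e s t) (eval_s M e s u)"
| "sat M e s (Disjoint t u) \<longleftrightarrow> disjoint_rel M (eval_s M e s t) (eval_s M e s u)"
| "sat M e s (Evencard t) \<longleftrightarrow> evencard_rel M (eval_s M e s t)"
| "sat M e s (Equalcard t u) \<longleftrightarrow> equalcard_rel M (eval_s M e s t) (eval_s M e s u)"
| "sat M e s (Neg \<phi>) \<longleftrightarrow> \<not> sat M e s \<phi>"
| "sat M e s (And \<phi> \<psi>) \<longleftrightarrow> sat M e s \<phi> \<and> sat M e s \<psi>"
| "sat M e s (Or \<phi> \<psi>) \<longleftrightarrow> sat M e s \<phi> \<or> sat M e s \<psi>"
| "sat M e s (AllE i \<phi>) \<longleftrightarrow> (\<forall>x \<in> dom_elem M. sat M (e(i := x)) s \<phi>)"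
| "sat M e s (AllS i \<phi>) \<longleftrightarrow> (\<forall>A \<in> dom_set M. sat M e (s(i := A)) \<phi>)"
| "sat M e s (ExE i \<phi>) \<longleftrightarrow> (\<exists>x \<in> dom_elem M. sat M (e(i := x)) s \<phi>)"
| "sat M e s (ExS i \<phi>) \<longleftrightarrow> (\<exists>A \<in> dom_set M. sat M e (s(i := A)) \<phi>)"

text \<open>
  The truth value of a sentence does not depend on the assignments;
  these are deliberately not required to take values in the domains, which may be empty.
\<close>

definition true_in :: "('e, 's) mslsp \<Rightarrow> fm \<Rightarrow> bool" where
  "true_in M \<phi> \<longleftrightarrow> (\<forall>e s. sat M e s \<phi>)"


section \<open>Structures for set preferences\<close>

definition set_pref_structure :: "('a, 'a set) mslsp \<Rightarrow> bool" where
  "set_pref_structure M \<longleftrightarrow>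
     mslsp_structure M \<and>
     dom_set M \<subseteq> Pow (dom_elem M) \<and>
     (\<forall>x \<in> dom_elem M. \<forall>A \<in> dom_set M. mem_rel M x A \<longleftrightarrow> x \<in> A)"

text \<open>
  HOL cannot quantify over all types inside a formula, so the type of which the element domains
  are subsets is a parameter.  Equivalence in all structures whatsoever implies this notion for
  every type \<open>'a\<close>, so as a hypothesis it is never stronger than the unrestricted one.
\<close>

definition esg_equivalent :: "'a itself \<Rightarrow> fm \<Rightarrow> bool" where
  "esg_equivalent (_ :: 'a itself) \<phi> \<longleftrightarrow>
     (\<exists>\<psi>. sentence \<psi> \<and> esg \<psi> \<and>
        (\<forall>M :: ('a, 'a set) mslsp. set_pref_structure M \<longrightarrow> (true_in M \<phi> \<longleftrightarrow> true_in M \<psi>)))"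

abbreviation nonempty_subsets :: "'a set \<Rightarrow> 'a set set" where
  "nonempty_subsets X \<equiv> Pow X - {{}}"

text \<open>
  Since \<^term>\<open>card A = 0\<close> for infinite \<^term>\<open>A\<close>, the two cardinality predicates are not stated
  by means of \<^const>\<open>card\<close> alone.
\<close>

definition pref_structure :: "'a set \<Rightarrow> 'a rel \<Rightarrow> 'a set rel \<Rightarrow> ('a, 'a set) mslsp" where
  "pref_structure X geq R = \<lparr>
     dom_elem = X,
     dom_set = nonempty_subsets X,
     mem_rel = (\<lambda>x A. x \<in> A),
     geq_rel = (\<lambda>x y. (x, y) \<in> geq),
     pref_rel = (\<lambda>A B. (A, B) \<in> R),
     subset_rel = (\<lambda>A B. A \<subseteq> B),
     disjoint_rel = (\<lambda>A B. A \<inter> B = {}),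
     evencard_rel = (\<lambda>A. finite A \<and> even (card A)),
     equalcard_rel = (\<lambda>A B. A \<approx> B),
     cup_fun = (\<lambda>A B. A \<union> B),
     sing_fun = (\<lambda>x. {x}),
     replace_fun = (\<lambda>a A b. (A - {a}) \<union> {b})\<rparr>"

definition satisfies :: "'a set \<Rightarrow> 'a rel \<Rightarrow> 'a set rel \<Rightarrow> fm set \<Rightarrow> bool" where
  "satisfies X geq R \<Gamma> \<longleftrightarrow> (\<forall>\<phi> \<in> \<Gamma>. true_in (pref_structure X geq R) \<phi>)"

end

theory Submission
  imports Defs
begin

text \<open>
  Truth of an ESG formula is inherited by substructures: universal quantifiers range over fewer
  objects, and a witness \<open>y \<in> t\<close> of a guarded existential quantifier lies in the smaller
  element domain because the value of \<open>t\<close> is a subset of it.  So a relation satisfying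
  \<open>\<Gamma>\<close> on a large set restricts to one on any of its \<open>n\<close>-element subsets.
\<close>

lemma linear_order_on_Restr:
  assumes "linear_order_on X r" "Y \<subseteq> X"
  shows "linear_order_on Y (Restr r Y)"
  using assms
  unfolding linear_order_on_def partial_order_on_def preorder_on_def refl_on_def total_on_def
    trans_def antisym_def
  by blast

lemma pref_structure_sel [simp]:
  "dom_elem (pref_structure X geq R) = X"
  "dom_set (pref_structure X geq R) = nonempty_subsets X"
  "mem_rel (pref_structure X geq R) = (\<lambda>x A. x \<in> A)"
  "geq_rel (pref_structure X geq R) = (\<lambda>x y. (x, y) \<in> geq)"
  "pref_rel (pref_structure X geq R) = (\<lambda>A B. (A, B) \<in> R)"
  "subset_rel (pref_structure X geq R) = (\<lambda>A B. A \<subseteq> B)"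
  "disjoint_rel (pref_structure X geq R) = (\<lambda>A B. A \<inter> B = {})"
  "evencard_rel (pref_structure X geq R) = (\<lambda>A. finite A \<and> even (card A))"
  "equalcard_rel (pref_structure X geq R) = (\<lambda>A B. A \<approx> B)"
  "cup_fun (pref_structure X geq R) = (\<lambda>A B. A \<union> B)"
  "sing_fun (pref_structure X geq R) = (\<lambda>x. {x})"
  "replace_fun (pref_structure X geq R) = (\<lambda>a A b. (A - {a}) \<union> {b})"
  by (simp_all add: pref_structure_def)

text \<open>Leaving out the empty set costs no closure: unions of nonempty sets and singletons are
  nonempty, and a replacement contains the inserted element.\<close>

lemma set_pref_structure_pref_structure: "set_pref_structure (pref_structure X geq R)"
  unfolding set_pref_structure_def mslsp_structure_def by auto

text \<open>Needed for guards: the value of a guard term does not change when the bound variable,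
  which it does not contain, is reassigned.\<close>

lemma eval_s_cong_evars:
  assumes "\<And>i. i \<in> evars_sterm t \<Longrightarrow> e i = e' i"
  shows "eval_s M e s t = eval_s M e' s t"
  using assms
proof (induction t)
  case (Sing a)
  then show ?case by (cases a) simp
next
  case (ReplaceInBy a t b)
  then show ?case by (cases a; cases b) simp
qed auto

text \<open>The three function symbols are interpreted by set operations that do not refer to the
  carrier or the relations, so a term has literally the same value in any two such
  structures.\<close>

lemma eval_s_pref_structure:
  "eval_s (pref_structure X geq R) e s t = eval_s (pref_structure Y geq' R') e s t"
  by (induction t) simp_all

lemma eval_e_in_dom: "(\<And>i. i \<in> evars_eterm a \<Longrightarrow> e i \<in> Y) \<Longrightarrow> eval_e e a \<in> Y"
  by (cases a) simp

lemma eval_s_in_dom: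
  assumes "mslsp_structure M"
    and "\<And>i. i \<in> evars_sterm t \<Longrightarrow> e i \<in> dom_elem M"
    and "\<And>i. i \<in> svars_sterm t \<Longrightarrow> s i \<in> dom_set M"
  shows "eval_s M e s t \<in> dom_set M"
  using assms(2,3)
proof (induction t)
  case (Cup t u)
  then show ?case using assms(1) by (simp add: mslsp_structure_def)
next
  case (Sing a)
  then show ?case using assms(1) by (simp add: mslsp_structure_def eval_e_in_dom)
next
  case (ReplaceInBy a t b)
  then show ?case using assms(1) by (simp add: mslsp_structure_def eval_e_in_dom)
qed simp

text \<open>Only free variables are constrained, because a domain may be empty and then no
  assignment takes all its values there. For sentences the condition is vacuous.\<close>

definition adapted :: "('e, 's) mslsp \<Rightarrow> (nat \<Rightarrow> 'e) \<Rightarrow> (nat \<Rightarrow> 's) \<Rightarrow> fm \<Rightarrow> bool" where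
  "adapted M e s \<phi> \<longleftrightarrow>
     (\<forall>i \<in> free_evars \<phi>. e i \<in> dom_elem M) \<and> (\<forall>i \<in> free_svars \<phi>. s i \<in> dom_set M)"

context
  fixes X Y :: "'a set" and geq :: "'a rel" and R :: "'a set rel"
  assumes YX: "Y \<subseteq> X"
begin

abbreviation (input) "big \<equiv> pref_structure X geq R"

abbreviation (input) "small \<equiv>
  pref_structure Y (Restr geq Y) (Restr R (nonempty_subsets Y))"

lemma eval_s_small:
  assumes "\<And>i. i \<in> evars_sterm t \<Longrightarrow> e i \<in> Y"
    and "\<And>i. i \<in> svars_sterm t \<Longrightarrow> s i \<in> nonempty_subsets Y"
  shows "eval_s small e s t \<in> nonempty_subsets Y"
proof -
  have "mslsp_structure small"
    using set_pref_structure_pref_structure set_pref_structure_def by blast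
  then have "eval_s small e s t \<in> dom_set small"
    using assms by (intro eval_s_in_dom) simp_all
  then show ?thesis by (simp only: pref_structure_sel)
qed

text \<open>Only \<open>Geq\<close> and \<open>Pref\<close> are interpreted differently in the two
  structures, and their restrictions agree with the originals on arguments from the smaller domains.
  Being an equivalence, this passes through negation.\<close>

lemma sat_quantifier_free_iff:
  assumes "quantifier_free \<phi>" "adapted small e s \<phi>"
  shows "sat big e s \<phi> \<longleftrightarrow> sat small e s \<phi>"
proof -
  note eval_eq = eval_s_pref_structure
    [of X geq R _ _ _ Y "Restr geq Y" "Restr R (nonempty_subsets Y)"]
  show ?thesis
    using assms
  proof (induction \<phi>)
    case (Geq a b)
    then have "eval_e e a \<in> Y" "eval_e e b \<in> Y"
      by (auto simp: adapted_def intro!: eval_e_in_dom)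
    then show ?case by simp
  next
    case (Pref t u)
    then have "eval_s small e s t \<in> nonempty_subsets Y" "eval_s small e s u \<in> nonempty_subsets Y"
      by (auto simp only: adapted_def pref_structure_sel free_evars.simps free_svars.simps
          intro!: eval_s_small)
    then show ?case by (simp add: eval_eq)
  qed (auto simp: adapted_def eval_eq)
qed

text \<open>Outside quantifier-free parts an ESG formula contains no negation, so one direction is
  enough for the induction.\<close>

lemma sat_esg_restrict:
  assumes "esg \<phi>" "adapted small e s \<phi>" "sat big e s \<phi>"
  shows "sat small e s \<phi>"
  using assms
proof (induction arbitrary: e s)
  case (esg_qf \<phi>)
  then show ?case by (simp add: sat_quantifier_free_iff)
next
  case (esg_And \<phi> \<psi>)
  then show ?case by (simp add: adapted_def)
next
  case (esg_Or \<phi> \<psi>)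
  then show ?case by (auto simp: adapted_def)
next
  case (esg_AllE \<phi> i)
  have "sat small (e(i := x)) s \<phi>" if "x \<in> Y" for x
  proof (rule esg_AllE.IH)
    show "adapted small (e(i := x)) s \<phi>"
      using esg_AllE.prems(1) that by (auto simp: adapted_def)
    show "sat big (e(i := x)) s \<phi>"
      using esg_AllE.prems(2) that YX by auto
  qed
  then show ?case by simp
next
  case (esg_AllS \<phi> i)
  have "sat small e (s(i := A)) \<phi>" if "A \<in> nonempty_subsets Y" for A
  proof (rule esg_AllS.IH)
    show "adapted small e (s(i := A)) \<phi>"
      using esg_AllS.prems(1) that by (auto simp: adapted_def)
    show "sat big e (s(i := A)) \<phi>"
      using esg_AllS.prems(2) that YX by auto
  qed
  then show ?case by simp
next
  case (esg_ExE \<phi> i t)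
  \<comment> \<open>The witness is so far known only to lie in \<open>X\<close>; the guard must
    bring it into \<open>Y\<close>.\<close>
  from esg_ExE.prems(2) obtain x
    where x: "x \<in> eval_s big (e(i := x)) s t" "sat big (e(i := x)) s \<phi>"
    by auto
  let ?A = "eval_s small (e(i := x)) s t"
  have xA: "x \<in> ?A"
    using x(1) by (simp only: eval_s_pref_structure[of X geq R _ _ _ Y "Restr geq Y"
      "Restr R (nonempty_subsets Y)"])
  \<comment> \<open>Since \<open>x \<in> Y\<close> is still open, closure of the small structure
    cannot be used under \<open>e(i := x)\<close>. The guard does not mention \<open>i\<close>, so
    its value can be computed under \<open>e\<close>, which is adapted to its variables.\<close>
  have "?A = eval_s small e s t"
    using esg_ExE.hyps by (intro eval_s_cong_evars) auto
  also have "\<dots> \<in> nonempty_subsets Y"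
    using esg_ExE.prems(1) esg_ExE.hyps
    by (intro eval_s_small) (auto simp: adapted_def)
  finally have "x \<in> Y" using xA by blast
  moreover have "sat small (e(i := x)) s \<phi>"
  proof (rule esg_ExE.IH)
    show "adapted small (e(i := x)) s \<phi>"
      using esg_ExE.prems(1) \<open>x \<in> Y\<close> by (auto simp: adapted_def)
  qed (fact x(2))
  ultimately show ?case using xA by auto
qed

lemma true_in_esg_restrict:
  assumes "sentence \<phi>" "esg \<phi>" "true_in big \<phi>"
  shows "true_in small \<phi>"
  using assms sat_esg_restrict by (simp add: true_in_def sentence_def adapted_def)

text \<open>The equivalence with an ESG sentence is used twice: in the big structure to pass to that
  sentence, and in the small one to return. Both are structures for set preferences over the same
  type.\<close>

lemma true_in_restrict:
  assumes "sentence \<phi>" "esg \<phi> \<or> esg_equivalent TYPE('a) \<phi>" "true_in big \<phi>"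
  shows "true_in small \<phi>"
  using assms true_in_esg_restrict set_pref_structure_pref_structure
  unfolding esg_equivalent_def by blast

end

theorem corollary1:
  fixes \<Gamma> :: "fm set" and n :: nat
  assumes axioms: "\<And>\<phi>. \<phi> \<in> \<Gamma> \<Longrightarrow> sentence \<phi> \<and> (esg \<phi> \<or> esg_equivalent TYPE('a) \<phi>)"
    and base: "\<And>(Y :: 'a set) geq. finite Y \<Longrightarrow> card Y = n \<Longrightarrow> linear_order_on Y geq \<Longrightarrow>
      \<not> (\<exists>R \<subseteq> nonempty_subsets Y \<times> nonempty_subsets Y. satisfies Y geq R \<Gamma>)"
  shows "\<And>(X :: 'a set) geq. infinite X \<or> n < card X \<Longrightarrow> linear_order_on X geq \<Longrightarrow>
      \<not> (\<exists>R \<subseteq> nonempty_subsets X \<times> nonempty_subsets X. satisfies X geq R \<Gamma>)"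
proof
  fix X :: "'a set" and geq
  assume size: "infinite X \<or> n < card X" and lin: "linear_order_on X geq"
  assume "\<exists>R \<subseteq> nonempty_subsets X \<times> nonempty_subsets X. satisfies X geq R \<Gamma>"
  then obtain R where R: "satisfies X geq R \<Gamma>" by blast
  \<comment> \<open>An infinite set has finite subsets of every size; a finite \<open>X\<close> has
    one of size \<open>n\<close> because \<open>n \<le> card X\<close>.\<close>
  obtain Y where Y: "Y \<subseteq> X" "finite Y" "card Y = n"
    using size infinite_arbitrarily_large[of X n] obtain_subset_with_card_n[of n X]
    by (metis less_imp_le)
  have "satisfies Y (Restr geq Y) (Restr R (nonempty_subsets Y)) \<Gamma>"
    using R axioms true_in_restrict[OF Y(1)] unfolding satisfies_def by blast
  then show False
    using base[OF Y(2,3) linear_order_on_Restr[OF lin Y(1)]] by blast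
qed

end
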